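(* Let $f:\mathbb{B}^n\to\mathbb{B}^N$ be a proper holomorphic map. Then: (1) $\Gamma_f$ is a Lie subgroup of $\mathrm{Aut}(\mathbb{B}^n)$; (2) $T_f$ is a Lie subgroup of $\mathrm{Aut}(\mathbb{B}^N)$; (3) $\Gamma_f$ is noncompact if and only if $T_f$ is noncompact.
   Context: $\mathbb{B}^k$ is the open unit ball in $\mathbb{C}^k$ and $\mathrm{Aut}(\mathbb{B}^k)$ is its group of holomorphic automorphisms, a Lie group (the quotient of $\mathbf{SU}(k,1)$ by its center), whose topology is that of pointwise (equivalently, locally uniform) convergence on $\mathbb{B}^k$. For holomorphic $f:\mathbb{B}^n\to\mathbb{B}^N$, let $A_f$ be the group of pairs $(\gamma,\psi)\in \mathrm{Aut}(\mathbb{B}^n)\times\mathrm{Aut}(\mathbb{B}^N)$ with $f\circ\gamma=\psi\circ f$; $\Gamma_f$ and $T_f$ are the projections of $A_f$ to the first and second factors. "Lie subgroup" here means closed subgroup. *)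

theory Defs
  imports "HOL-Analysis.Analysis" "HOL-Algebra.Bij"
begin

text \<open>
  The norm on \<open>complex ^ 'k\<close> is the Hermitian one, so \<open>ball 0 1\<close> is the open unit ball
  of complex Euclidean space of dimension \<open>CARD('k)\<close>.

  Holomorphic means complex differentiable: at every point there is a (real) Frechet
  derivative that is moreover complex linear. The notion is only meant for open \<open>S\<close>, where
  it does not depend on the values of the map outside \<open>S\<close>.
\<close>

definition holomorphic_map_on :: "(complex ^ 'n \<Rightarrow> complex ^ 'm) \<Rightarrow> (complex ^ 'n) set \<Rightarrow> bool"
  where "holomorphic_map_on f S \<longleftrightarrow>
    (\<forall>z\<in>S. \<exists>D. (f has_derivative D) (at z) \<and> (\<forall>c v. D (c *s v) = c *s D v))"

text \<open>
  The library constant \<^const>\<open>proper_map\<close> means closed with compact fibres; see the lemma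
  \<open>proper_holomorphic_iff_compact_preimages\<close> below for compact preimages.
\<close>

definition proper_holomorphic :: "(complex ^ 'n \<Rightarrow> complex ^ 'm) \<Rightarrow> bool"
  where "proper_holomorphic f \<longleftrightarrow> f \<in> ball 0 1 \<rightarrow> ball 0 1 \<and> holomorphic_map_on f (ball 0 1) \<and>
    proper_map (top_of_set (ball 0 1)) (top_of_set (ball 0 1)) f"

text \<open>
  As in \<^const>\<open>BijGroup\<close>, an automorphism of the ball is represented by its extensional
  version (\<open>undefined\<close> outside the ball), so that maps agreeing on the ball are equal.
\<close>

definition ball_aut :: "(complex ^ 'k \<Rightarrow> complex ^ 'k) monoid"
  where "ball_aut = BijGroup (ball 0 1)
    \<lparr>carrier := {g \<in> Bij (ball 0 1). holomorphic_map_on g (ball 0 1) \<and>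
                   holomorphic_map_on (inv_into (ball 0 1) g) (ball 0 1)}\<rparr>"

text \<open>The topology of pointwise convergence on the ball.\<close>

definition ball_aut_topology :: "(complex ^ 'k \<Rightarrow> complex ^ 'k) topology"
  where "ball_aut_topology =
    subtopology (product_topology (\<lambda>_. top_of_set (ball 0 1)) (ball 0 1)) (carrier ball_aut)"

definition ball_aut_lie_subgroup :: "(complex ^ 'k \<Rightarrow> complex ^ 'k) set \<Rightarrow> bool"
  where "ball_aut_lie_subgroup H \<longleftrightarrow> subgroup H ball_aut \<and> closedin ball_aut_topology H"

definition equivariance_group ::
    "(complex ^ 'n \<Rightarrow> complex ^ 'm) \<Rightarrow>
      ((complex ^ 'n \<Rightarrow> complex ^ 'n) \<times> (complex ^ 'm \<Rightarrow> complex ^ 'm)) set" ("A\<^bsub>_\<^esub>")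
  where "A\<^bsub>f\<^esub> = {(\<gamma>, \<psi>). \<gamma> \<in> carrier ball_aut \<and> \<psi> \<in> carrier ball_aut \<and>
                  (\<forall>z\<in>ball 0 1. f (\<gamma> z) = \<psi> (f z))}"

definition source_group ::
    "(complex ^ 'n \<Rightarrow> complex ^ 'm) \<Rightarrow> (complex ^ 'n \<Rightarrow> complex ^ 'n) set" ("\<Gamma>\<^bsub>_\<^esub>")
  where "\<Gamma>\<^bsub>f\<^esub> = fst ` A\<^bsub>f\<^esub>"

definition target_group ::
    "(complex ^ 'n \<Rightarrow> complex ^ 'm) \<Rightarrow> (complex ^ 'm \<Rightarrow> complex ^ 'm) set" ("T\<^bsub>_\<^esub>")
  where "T\<^bsub>f\<^esub> = snd ` A\<^bsub>f\<^esub>"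


lemma holomorphic_map_on_imp_continuous_on:
  "holomorphic_map_on f S \<Longrightarrow> continuous_on S f"
  unfolding holomorphic_map_on_def
  by (blast intro: continuous_at_imp_continuous_on has_derivative_continuous)

lemma proper_holomorphic_iff_compact_preimages:
  fixes f :: "complex ^ 'n \<Rightarrow> complex ^ 'm"
  shows "proper_holomorphic f \<longleftrightarrow>
    f \<in> ball 0 1 \<rightarrow> ball 0 1 \<and> holomorphic_map_on f (ball 0 1) \<and>
    (\<forall>K. compact K \<and> K \<subseteq> ball 0 1 \<longrightarrow> compact {z \<in> ball 0 1. f z \<in> K})"
proof -
  let ?X = "top_of_set (ball 0 1 :: (complex ^ 'n) set)"
  let ?Y = "top_of_set (ball 0 1 :: (complex ^ 'm) set)"
  have "metrizable_space ?Y"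
    by (simp add: metrizable_space_subtopology metrizable_space_euclidean)
  then have "k_space ?Y"
    by (rule metrizable_imp_k_space)
  moreover have "kc_space ?X" "kc_space ?Y"
    by (simp_all add: Hausdorff_imp_kc_space Hausdorff_space_subtopology)
  ultimately have "proper_map ?X ?Y f \<longleftrightarrow>
      f \<in> topspace ?X \<rightarrow> topspace ?Y \<and>
      (\<forall>K. compactin ?Y K \<longrightarrow> compactin ?X {x \<in> topspace ?X. f x \<in> K})"
    by (intro proper_eq_compact_map) auto
  then show ?thesis
    unfolding proper_holomorphic_def by (auto simp: compactin_subtopology)
qed

lemma holomorphic_map_on_compose:
  assumes "holomorphic_map_on f S" "holomorphic_map_on g T" "f ` S \<subseteq> T"
  shows "holomorphic_map_on (g \<circ> f) S"
  unfolding holomorphic_map_on_def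
proof
  fix z assume "z \<in> S"
  with assms obtain D E where D: "(f has_derivative D) (at z)" "\<And>c v. D (c *s v) = c *s D v"
    and E: "(g has_derivative E) (at (f z))" "\<And>c v. E (c *s v) = c *s E v"
    unfolding holomorphic_map_on_def by (meson image_subset_iff)
  have "(g \<circ> f has_derivative E \<circ> D) (at z)"
    using diff_chain_at D(1) E(1) by blast
  then show "\<exists>D. (g \<circ> f has_derivative D) (at z) \<and> (\<forall>c v. D (c *s v) = c *s D v)"
    using D(2) E(2) by (intro exI[of _ "E \<circ> D"]) simp
qed

lemma holomorphic_map_on_cong:
  assumes "open S" "\<And>z. z \<in> S \<Longrightarrow> f z = g z"
  shows "holomorphic_map_on f S \<longleftrightarrow> holomorphic_map_on g S"
proof -
  have "(f has_derivative D) (at z) \<longleftrightarrow> (g has_derivative D) (at z)" if "z \<in> S" for z D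
    using has_derivative_transform_within_open[of f D z UNIV S g]
      has_derivative_transform_within_open[of g D z UNIV S f] assms that by auto
  then show ?thesis
    unfolding holomorphic_map_on_def by simp
qed

lemma group_ball_aut: "group (ball_aut :: (complex ^ 'k \<Rightarrow> complex ^ 'k) monoid)"
proof -
  define B where "B = (ball 0 1 :: (complex ^ 'k) set)"
  have opn: "open B" by (simp add: B_def)
  let ?H = "{g \<in> Bij B. holomorphic_map_on g B \<and> holomorphic_map_on (inv_into B g) B}"
  have img: "g ` B = B" "inv_into B g ` B = B" if "g \<in> Bij B" for g
    using that bij_betw_inv_into[of g B B] by (auto simp: Bij_def bij_betw_def)
  interpret G: group "BijGroup B" by (rule group_BijGroup)
  have "subgroup ?H (BijGroup B)"
  proof (rule G.subgroupI)
    show "?H \<subseteq> carrier (BijGroup B)" by (auto simp: BijGroup_def)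
    let ?i = "\<lambda>x\<in>B. x"
    have "holomorphic_map_on (\<lambda>x. x) B"
      unfolding holomorphic_map_on_def by (auto intro!: exI[of _ "\<lambda>x. x"])
    moreover have "inv_into B ?i z = z" if "z \<in> B" for z
      using inv_into_f_f[of ?i B z] that by (auto simp: inj_on_def)
    ultimately have "?i \<in> ?H"
      using holomorphic_map_on_cong[OF opn, of ?i "\<lambda>x. x"]
        holomorphic_map_on_cong[OF opn, of "inv_into B ?i" "\<lambda>x. x"] id_Bij by auto
    then show "?H \<noteq> {}" by blast
  next
    fix g assume g: "g \<in> ?H"
    let ?g' = "restrict (inv_into B g) B"
    have g': "?g' \<in> Bij B" using g restrict_inv_into_Bij by blast
    have eq: "inv_into B ?g' z = g z" if "z \<in> B" for z
    proof (rule inv_into_f_eq)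
      show "inj_on ?g' B" using g' by (auto simp: Bij_def bij_betw_def)
      show "g z \<in> B" using g img that by blast
      then show "?g' (g z) = z" using g that by (simp add: Bij_def bij_betw_def)
    qed
    have "holomorphic_map_on ?g' B"
      using holomorphic_map_on_cong[OF opn, of ?g' "inv_into B g"] g by auto
    moreover have "holomorphic_map_on (inv_into B ?g') B"
      using holomorphic_map_on_cong[OF opn, of "inv_into B ?g'" g] eq g by auto
    ultimately show "inv\<^bsub>BijGroup B\<^esub> g \<in> ?H"
      using g g' by (simp add: inv_BijGroup)
  next
    fix g h assume g: "g \<in> ?H" and h: "h \<in> ?H"
    let ?c = "compose B g h"
    let ?d = "inv_into B h \<circ> inv_into B g"
    have c: "?c \<in> Bij B" using g h by (simp add: compose_Bij)
    have eq: "inv_into B ?c z = ?d z" if z: "z \<in> B" for z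
    proof (rule inv_into_f_eq)
      show "inj_on ?c B" using c by (auto simp: Bij_def bij_betw_def)
      have 1: "inv_into B g z \<in> B" using g z img by blast
      then show 2: "?d z \<in> B" using h img by auto
      show "?c (?d z) = z"
        using 1 2 g h z img by (simp add: compose_def f_inv_into_f)
    qed
    have "holomorphic_map_on (g \<circ> h) B" "holomorphic_map_on ?d B"
      using g h img by (auto intro!: holomorphic_map_on_compose[where T = B])
    then have "holomorphic_map_on ?c B" "holomorphic_map_on (inv_into B ?c) B"
      using holomorphic_map_on_cong[OF opn, of ?c "g \<circ> h"]
        holomorphic_map_on_cong[OF opn, of "inv_into B ?c" ?d] eq by (auto simp: compose_def)
    then show "g \<otimes>\<^bsub>BijGroup B\<^esub> h \<in> ?H"
      using c g h by (simp add: BijGroup_def)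
  qed
  then show ?thesis
    unfolding ball_aut_def B_def by (rule subgroup.subgroup_is_group) (rule group_BijGroup)
qed

end

theory Submission
  imports Defs "HOL-Complex_Analysis.Conformal_Mappings"
begin

text \<open>
  Everything rests on the fact that the automorphism group of the ball acts properly: the
  automorphisms moving a given point into a given compact subset of the ball form a compact set
  (lemma \<open>compactin_ball_aut_eval\<close>). By the Schwarz lemma, automorphisms fixing the origin are
  unitary (lemma \<open>ball_aut_fixing_0_unitary\<close>), and explicit fractional linear maps
  (\<open>ball_translation\<close>) move the origin to any point and depend continuously on that point.
  So every automorphism is a product of translations and a unitary map, and the compactness of the
  unitary group gives the claim.

  Both groups are projections of the group \<open>A\<^bsub>f\<^esub>\<close>, which is cut out by closed conditions. The
  relation \<open>f (\<gamma> 0) = \<psi> (f 0)\<close> links the two factors: if \<open>\<gamma>\<close> varies near a fixed automorphism, then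
  \<open>\<psi> (f 0)\<close> stays in a compact subset of the ball, and so \<open>\<psi>\<close> stays in a compact set; if \<open>\<psi>\<close> varies
  near a fixed automorphism, then properness of \<open>f\<close> keeps \<open>\<gamma> 0\<close> in a compact subset of the ball, and
  so \<open>\<gamma>\<close> stays in a compact set. As projections along compact factors are closed, \<open>\<Gamma>\<^bsub>f\<^esub>\<close> and
  \<open>T\<^bsub>f\<^esub>\<close> are closed (lemma \<open>closedin_fst_coincidence\<close>). The same relation transfers compactness
  of one group to the orbit of \<open>f 0\<close> or \<open>0\<close> under the other, and hence to the other group.
\<close>

section \<open>The Hermitian form\<close>

definition hermitian_form :: "complex ^ 'k \<Rightarrow> complex ^ 'k \<Rightarrow> complex" ("\<langle>_, _\<rangle>")
  where "\<langle>z, w\<rangle> = (\<Sum>i\<in>UNIV. z $ i * cnj (w $ i))"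

lemma hermitian_form_add_left: "\<langle>x + y, w\<rangle> = \<langle>x, w\<rangle> + \<langle>y, w\<rangle>"
  and hermitian_form_add_right: "\<langle>z, x + y\<rangle> = \<langle>z, x\<rangle> + \<langle>z, y\<rangle>"
  and hermitian_form_diff_left: "\<langle>x - y, w\<rangle> = \<langle>x, w\<rangle> - \<langle>y, w\<rangle>"
  and hermitian_form_diff_right: "\<langle>z, x - y\<rangle> = \<langle>z, x\<rangle> - \<langle>z, y\<rangle>"
  and hermitian_form_minus_right: "\<langle>z, - w\<rangle> = - \<langle>z, w\<rangle>"
  and hermitian_form_scale_left: "\<langle>c *s z, w\<rangle> = c * \<langle>z, w\<rangle>"
  and hermitian_form_scale_right: "\<langle>z, c *s w\<rangle> = cnj c * \<langle>z, w\<rangle>"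
  and cnj_hermitian_form: "cnj \<langle>z, w\<rangle> = \<langle>w, z\<rangle>"
  by (simp_all add: hermitian_form_def algebra_simps sum.distrib sum_distrib_left sum_negf sum_subtractf)

lemmas hermitian_form_simps = hermitian_form_add_left hermitian_form_add_right
  hermitian_form_diff_left hermitian_form_diff_right
  hermitian_form_minus_right hermitian_form_scale_left hermitian_form_scale_right

lemma hermitian_form_self: "\<langle>z, z\<rangle> = complex_of_real ((norm z)\<^sup>2)"
proof -
  have "complex_of_real ((norm z)\<^sup>2) = (\<Sum>i\<in>UNIV. complex_of_real ((norm (z $ i))\<^sup>2))"
    by (simp add: norm_vec_def L2_set_def sum_nonneg)
  also have "\<dots> = \<langle>z, z\<rangle>"
    by (simp only: hermitian_form_def complex_norm_square)
  finally show ?thesis ..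
qed

lemma hermitian_form_zero [simp]: "\<langle>0, w\<rangle> = 0" "\<langle>z, 0\<rangle> = 0"
  by (simp_all add: hermitian_form_def)

lemma norm_hermitian_form_le: "norm \<langle>z, w\<rangle> \<le> norm z * norm w"
proof -
  have "norm \<langle>z, w\<rangle> \<le> (\<Sum>i\<in>UNIV. \<bar>norm (z $ i)\<bar> * \<bar>norm (w $ i)\<bar>)"
    unfolding hermitian_form_def by (rule order_trans[OF norm_sum]) (simp add: norm_mult)
  also have "\<dots> \<le> norm z * norm w"
    unfolding norm_vec_def by (rule L2_set_mult_ineq)
  finally show ?thesis .
qed

lemma norm_hermitian_form_less_1:
  assumes "norm z < 1" "norm w \<le> 1"
  shows "norm \<langle>z, w\<rangle> < 1"
proof -
  have "norm z * norm w \<le> norm z" using assms by (simp add: mult_left_le)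
  then show ?thesis using norm_hermitian_form_le[of z w] assms by linarith
qed

lemma bounded_linear_hermitian_form: "bounded_linear (\<lambda>z. \<langle>z, w\<rangle>)"
proof (rule bounded_linear_intro[where K = "norm w"])
  fix r :: real and x
  show "\<langle>r *\<^sub>R x, w\<rangle> = r *\<^sub>R \<langle>x, w\<rangle>"
    by (simp add: hermitian_form_def scaleR_sum_right)
qed (auto simp: hermitian_form_add_left norm_hermitian_form_le)

lemma norm_scale: "norm (c *s z) = norm c * norm z" for z :: "complex ^ 'k"
  by (simp add: norm_vec_def norm_mult L2_set_right_distrib)

lemma bounded_bilinear_scale: "bounded_bilinear (\<lambda>c (z :: complex ^ 'k). c *s z)"
proof
  show "\<exists>K. \<forall>c (z :: complex ^ 'k). norm (c *s z) \<le> norm c * norm z * K"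
    by (rule exI[of _ 1]) (simp add: norm_scale)
qed (simp_all add: vec_eq_iff algebra_simps)

lemma of_real_scale: "complex_of_real r *s z = r *\<^sub>R z"
  by (simp add: vec_eq_iff scaleR_conv_of_real[where 'a = complex])

lemma continuous_on_scale:
  "continuous_on S f \<Longrightarrow> continuous_on S g \<Longrightarrow> continuous_on S (\<lambda>x. f x *s (g x :: complex ^ 'k))"
  by (rule bounded_bilinear.continuous_on[OF bounded_bilinear_scale])

lemma continuous_on_hermitian_form:
  "continuous_on S f \<Longrightarrow> continuous_on S g \<Longrightarrow> continuous_on S (\<lambda>x. \<langle>f x, g x\<rangle>)"
  unfolding hermitian_form_def by (intro continuous_intros) auto

section \<open>Automorphisms moving the origin\<close>

text \<open>
  With \<open>s = sqrt (1 - |a|^2)\<close>, this is the automorphism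
  \<open>z \<mapsto> (a + P z + s (z - P z)) / (1 + \<langle>z, a\<rangle>)\<close> sending \<open>0\<close> to \<open>a\<close>, where \<open>P\<close> is the orthogonal
  projection to the line through \<open>a\<close>; the analogue of a Moebius transformation of the disc.
  Because \<open>P z = (\<langle>z, a\<rangle> / |a|^2) a\<close> and \<open>|a|^2 = (1 - s) (1 + s)\<close>, the numerator can be written
  without dividing by \<open>|a|^2\<close>, so that \<open>a = 0\<close> is no exception and continuity in \<open>a\<close> is evident.
\<close>

definition ball_translation :: "complex ^ 'k \<Rightarrow> complex ^ 'k \<Rightarrow> complex ^ 'k"
  where "ball_translation a z =
    (let s = complex_of_real (sqrt (1 - (norm a)\<^sup>2)) in
      inverse (1 + \<langle>z, a\<rangle>) *s ((1 + \<langle>z, a\<rangle> / (1 + s)) *s a + s *s z))"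

lemma one_plus_hermitian_form_nonzero:
  assumes "norm z < 1" "norm a < 1" shows "1 + \<langle>z, a\<rangle> \<noteq> 0"
proof
  assume "1 + \<langle>z, a\<rangle> = 0"
  then have "\<langle>z, a\<rangle> = -1" by (simp add: eq_neg_iff_add_eq_0 add.commute)
  then show False using norm_hermitian_form_less_1[of z a] assms by simp
qed

lemma one_plus_sqrt_nonzero: 
  assumes "norm a < 1"
  shows "1 + complex_of_real (sqrt (1 - (norm a)\<^sup>2)) \<noteq> 0"
proof -
  have "0 \<le> sqrt (1 - (norm a)\<^sup>2)" using assms by (simp add: abs_square_le_1)
  then have "1 + sqrt (1 - (norm a)\<^sup>2) \<noteq> 0" by linarith
  then show ?thesis by (metis of_real_1 of_real_add of_real_eq_0_iff)
qed

text \<open>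
  For \<open>d\<close> the denominator and \<open>N\<close> the numerator of \<open>ball_translation a z\<close>, direct expansion gives
  \<open>|d|^2 - |N|^2 = (1 - |a|^2) (1 - |z|^2)\<close>.
\<close>

lemma norm_ball_translation_less_1:
  assumes z: "norm z < 1" and a: "norm a < 1"
  shows "norm (ball_translation a z) < 1"
proof -
  define s where "s = sqrt (1 - (norm a)\<^sup>2)"
  define c where "c = \<langle>z, a\<rangle>"
  define q where "q = c / (1 + s)"
  define N where "N = (1 + q) *s a + s *s z"
  have s: "s > 0" "(norm a)\<^sup>2 = 1 - s\<^sup>2"
    using a by (simp_all add: s_def abs_square_less_1 abs_square_le_1)
  have s1: "1 + complex_of_real s \<noteq> 0" using one_plus_sqrt_nonzero[OF a] by (simp add: s_def)
  have c: "c = q * (1 + s)" using s1 by (simp add: q_def)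
  have d: "1 + c \<noteq> 0" unfolding c_def by (rule one_plus_hermitian_form_nonzero[OF z a])
  have az: "\<langle>a, z\<rangle> = cnj c" by (simp add: c_def cnj_hermitian_form)
  \<comment> \<open>With \<open>c = q (1 + s)\<close> substituted, this is a polynomial identity in \<open>q\<close>, its conjugate and \<open>s\<close>.\<close>
  have "(1 + c) * cnj (1 + c) - \<langle>N, N\<rangle> = s\<^sup>2 * (1 - (norm z)\<^sup>2)"
    unfolding N_def hermitian_form_simps hermitian_form_self[of a] hermitian_form_self[of z] az
    unfolding c_def[symmetric] s(2) unfolding c
    by (simp add: algebra_simps power2_eq_square)
  then have "complex_of_real ((norm (1 + c))\<^sup>2 - (norm N)\<^sup>2)
      = complex_of_real (s\<^sup>2 * (1 - (norm z)\<^sup>2))"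
    by (simp only: of_real_diff complex_norm_square[symmetric] hermitian_form_self)
  then have "(norm (1 + c))\<^sup>2 - (norm N)\<^sup>2 = s\<^sup>2 * (1 - (norm z)\<^sup>2)"
    by (simp only: of_real_eq_iff)
  moreover have "s\<^sup>2 * (1 - (norm z)\<^sup>2) > 0"
    using s z by (simp add: abs_square_less_1)
  ultimately have "norm N < norm (1 + c)"
    by (intro power2_less_imp_less[of "norm N"]) auto
  moreover have "ball_translation a z = inverse (1 + c) *s N"
    by (simp add: ball_translation_def s_def N_def c_def q_def Let_def)
  ultimately show ?thesis
    using d by (simp add: norm_scale norm_inverse norm_divide divide_simps)
qed

text \<open>
  The translation by \<open>- a\<close> has the same \<open>s\<close>. For \<open>w = ball_translation a z\<close>, its denominator at
  \<open>w\<close> is \<open>1 - \<langle>w, a\<rangle> = s^2 / (1 + \<langle>z, a\<rangle>)\<close>, and its numerator is \<open>s^2 z / (1 + \<langle>z, a\<rangle>)\<close>,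
  since the coefficient of \<open>a\<close> cancels.
\<close>

lemma ball_translation_minus:
  assumes z: "norm z < 1" and a: "norm a < 1"
  shows "ball_translation (- a) (ball_translation a z) = z"
proof -
  define s where "s = complex_of_real (sqrt (1 - (norm a)\<^sup>2))"
  define c where "c = \<langle>z, a\<rangle>"
  define q where "q = c / (1 + s)"
  define d where "d = inverse (1 + c)"
  define w where "w = ball_translation a z"
  have s1: "1 + s \<noteq> 0" using one_plus_sqrt_nonzero[OF a] by (simp add: s_def)
  have c: "c = q * (1 + s)" using s1 by (simp add: q_def)
  have nd: "1 + c \<noteq> 0" unfolding c_def by (rule one_plus_hermitian_form_nonzero[OF z a])
  have d: "d * (1 + c) = 1" using nd by (simp add: d_def)
  have s2: "complex_of_real ((norm a)\<^sup>2) = 1 - s\<^sup>2"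
    using a by (simp add: s_def flip: of_real_power) (simp add: abs_square_le_1)
  have s0: "s \<noteq> 0"
    using a abs_square_less_1[of "norm a"] by (simp add: s_def)
  have w: "w = d *s ((1 + q) *s a + s *s z)"
    by (simp add: w_def ball_translation_def s_def q_def c_def d_def Let_def)
  have wa: "\<langle>w, a\<rangle> = d * (1 - s\<^sup>2 + c)"
    unfolding w hermitian_form_simps hermitian_form_self s2 c_def[symmetric] unfolding c
    by (simp add: algebra_simps power2_eq_square)
  have e: "1 - \<langle>w, a\<rangle> = d * s\<^sup>2"
    using d unfolding wa by (simp add: algebra_simps)
  have r: "\<langle>w, a\<rangle> / (1 + s) = d * (1 - s + q)"
    using s1 unfolding wa unfolding c by (simp add: field_simps power2_eq_square)
  have "ball_translation (- a) w = inverse (1 - \<langle>w, a\<rangle>) *s ((1 - \<langle>w, a\<rangle> / (1 + s)) *s (- a) + s *s w)"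
    by (simp add: ball_translation_def s_def Let_def hermitian_form_minus_right)
  also have "(1 - \<langle>w, a\<rangle> / (1 + s)) *s (- a) + s *s w
      = (s * d * (1 + q) - 1 + d * (1 - s + q)) *s a + (d * s\<^sup>2) *s z"
    unfolding r unfolding w by (simp add: vec_eq_iff algebra_simps power2_eq_square)
  also have "s * d * (1 + q) - 1 + d * (1 - s + q) = d * (1 + c) - 1"
    unfolding c by (simp add: algebra_simps)
  also have "\<dots> = 0" using d by simp
  finally have "ball_translation (- a) w = (inverse (d * s\<^sup>2) * (d * s\<^sup>2)) *s z"
    by (simp add: e vec_eq_iff)
  also have "inverse (d * s\<^sup>2) * (d * s\<^sup>2) = 1"
    using s0 d by (intro left_inverse) auto
  finally show ?thesis by (simp add: w_def)
qed

lemma ball_translation_minus':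
  assumes "norm z < 1" "norm a < 1"
  shows "ball_translation a (ball_translation (- a) z) = z"
  using ball_translation_minus[of z "- a"] assms by simp

lemma ball_translation_0: "norm a < 1 \<Longrightarrow> ball_translation a 0 = a"
  by (simp add: ball_translation_def Let_def vec_eq_iff)

lemma continuous_on_ball_translation:
  assumes "continuous_on S a" "continuous_on S z"
    and "\<And>x. x \<in> S \<Longrightarrow> norm (a x) < 1" "\<And>x. x \<in> S \<Longrightarrow> norm (z x) < 1"
  shows "continuous_on S (\<lambda>x. ball_translation (a x) (z x))"
  unfolding ball_translation_def Let_def
  by (intro continuous_on_scale continuous_on_hermitian_form continuous_intros assms(1,2))
    (simp_all add: assms(3,4) one_plus_hermitian_form_nonzero one_plus_sqrt_nonzero)

lemma holomorphic_map_on_ball_translation: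
  assumes a: "norm a < 1"
  shows "holomorphic_map_on (ball_translation a) (ball 0 1)"
  unfolding holomorphic_map_on_def
proof
  fix z :: "complex ^ 'a" assume "z \<in> ball 0 1"
  then have z: "1 + \<langle>z, a\<rangle> \<noteq> 0" using one_plus_hermitian_form_nonzero a by simp
  define s where "s = complex_of_real (sqrt (1 - (norm a)\<^sup>2))"
  define v where "v = (\<lambda>z. (1 + \<langle>z, a\<rangle> / (1 + s)) *s a + s *s z)"
  define c' where "c' = (\<lambda>h. - (inverse (1 + \<langle>z, a\<rangle>) * \<langle>h, a\<rangle> * inverse (1 + \<langle>z, a\<rangle>)))"
  define v' where "v' = (\<lambda>h. (\<langle>h, a\<rangle> / (1 + s)) *s a + s *s h)"
  note H = bounded_linear_imp_has_derivative[OF bounded_linear_hermitian_form]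
  have 1: "((\<lambda>z. inverse (1 + \<langle>z, a\<rangle>)) has_derivative c') (at z)"
    unfolding c'_def by (rule Deriv.has_derivative_inverse[where f = "\<lambda>z. 1 + \<langle>z, a\<rangle>", OF z])
      (auto intro!: derivative_eq_intros H)
  have "((\<lambda>z. 1 + \<langle>z, a\<rangle> / (1 + s)) has_derivative (\<lambda>h. \<langle>h, a\<rangle> / (1 + s))) (at z)"
    unfolding divide_inverse by (auto intro!: derivative_eq_intros H)
  then have 2: "(v has_derivative v') (at z)"
    unfolding v_def v'_def
    by (intro has_derivative_add
        bounded_linear.has_derivative[OF bounded_bilinear.bounded_linear_left[OF bounded_bilinear_scale]]
        bounded_linear.has_derivative[OF bounded_bilinear.bounded_linear_right[OF bounded_bilinear_scale]]
        has_derivative_ident)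
  have "(ball_translation a has_derivative
      (\<lambda>h. inverse (1 + \<langle>z, a\<rangle>) *s v' h + c' h *s v z)) (at z)"
    using bounded_bilinear.FDERIV[OF bounded_bilinear_scale 1 2]
    by (simp add: ball_translation_def[abs_def] v_def s_def Let_def)
  moreover have "v' (c *s h) = c *s v' h" "c' (c *s h) = c * c' h" for c h
    by (simp_all add: v'_def c'_def hermitian_form_simps vec_eq_iff algebra_simps)
  ultimately show "\<exists>D. (ball_translation a has_derivative D) (at z) \<and> (\<forall>c h. D (c *s h) = c *s D h)"
    by (intro exI conjI) (auto simp: vec_eq_iff algebra_simps)
qed

section \<open>The automorphism group\<close>

lemma carrier_ball_autD:
  assumes "g \<in> carrier ball_aut"
  shows "holomorphic_map_on g (ball 0 1)" "g ` ball 0 1 = ball 0 1" "g \<in> extensional (ball 0 1)"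
  using assms by (auto simp: ball_aut_def Bij_def bij_betw_def)

lemma ball_aut_in_ball:
  assumes "g \<in> carrier ball_aut" "norm z < 1"
  shows "norm (g z) < 1"
proof -
  have "g z \<in> g ` ball 0 1" using assms(2) by simp
  then show ?thesis unfolding carrier_ball_autD(2)[OF assms(1)] by simp
qed

lemma one_ball_aut: "\<one>\<^bsub>ball_aut\<^esub> = (\<lambda>z\<in>ball 0 1. z)"
  by (simp add: ball_aut_def BijGroup_def)

lemma mult_ball_aut:
  assumes "g \<in> carrier ball_aut" "h \<in> carrier ball_aut"
  shows "g \<otimes>\<^bsub>ball_aut\<^esub> h = compose (ball 0 1) g h"
  using assms by (simp add: ball_aut_def BijGroup_def)

lemma mult_ball_aut_apply:
  assumes "g \<in> carrier ball_aut" "h \<in> carrier ball_aut" "norm z < 1"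
  shows "(g \<otimes>\<^bsub>ball_aut\<^esub> h) z = g (h z)"
  using assms by (simp add: mult_ball_aut compose_def)

lemma ball_aut_inv_apply:
  assumes g: "g \<in> carrier ball_aut" and z: "norm z < 1"
  shows "g ((inv\<^bsub>ball_aut\<^esub> g) z) = z" "(inv\<^bsub>ball_aut\<^esub> g) (g z) = z"
proof -
  interpret group ball_aut by (rule group_ball_aut)
  show "g ((inv\<^bsub>ball_aut\<^esub> g) z) = z" "(inv\<^bsub>ball_aut\<^esub> g) (g z) = z"
    using mult_ball_aut_apply[of g "inv\<^bsub>ball_aut\<^esub> g" z] mult_ball_aut_apply[of "inv\<^bsub>ball_aut\<^esub> g" g z] g z
    by (simp_all add: one_ball_aut)
qed

text \<open>
  Elements of the carrier are extensional, so a concrete automorphism enters the group only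
  through its restriction; a two-sided holomorphic inverse on the ball may be given by any formula.
\<close>

lemma restrict_in_carrier_ball_aut:
  assumes g: "holomorphic_map_on g (ball 0 1)" "\<And>z. norm z < 1 \<Longrightarrow> norm (g z) < 1"
    and h: "holomorphic_map_on h (ball 0 1)" "\<And>z. norm z < 1 \<Longrightarrow> norm (h z) < 1"
    and gh: "\<And>z. norm z < 1 \<Longrightarrow> g (h z) = z" and hg: "\<And>z. norm z < 1 \<Longrightarrow> h (g z) = z"
  shows "restrict g (ball 0 1) \<in> carrier ball_aut"
proof -
  let ?B = "ball 0 1 :: (complex ^ 'a) set"
  have bij: "bij_betw (restrict g ?B) ?B ?B"
    by (rule bij_betw_byWitness[where f' = h]) (use g(2) h(2) gh hg in auto)
  have "inv_into ?B (restrict g ?B) z = h z" if "z \<in> ?B" for z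
    by (rule inv_into_f_eq) (use bij h(2) gh that in \<open>auto simp: bij_betw_def\<close>)
  then have "holomorphic_map_on (inv_into ?B (restrict g ?B)) ?B"
    using holomorphic_map_on_cong[of ?B "inv_into ?B (restrict g ?B)" h] h(1) by auto
  moreover have "holomorphic_map_on (restrict g ?B) ?B"
    using holomorphic_map_on_cong[of ?B "restrict g ?B" g] g(1) by auto
  ultimately show ?thesis using bij by (auto simp: ball_aut_def Bij_def)
qed

lemma ball_translation_in_carrier:
  assumes a: "norm a < 1"
  shows "restrict (ball_translation a) (ball 0 1) \<in> carrier ball_aut"
proof (rule restrict_in_carrier_ball_aut)
  have a': "norm (- a) < 1" using a by simp
  show "holomorphic_map_on (ball_translation (- a)) (ball 0 1)"
    by (rule holomorphic_map_on_ball_translation[OF a'])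
  show "norm (ball_translation (- a) z) < 1" if "norm z < 1" for z
    by (rule norm_ball_translation_less_1[OF that a'])
qed (simp_all add: a holomorphic_map_on_ball_translation norm_ball_translation_less_1
    ball_translation_minus ball_translation_minus')

lemma bounded_linear_matrix_vector_mult: "bounded_linear (\<lambda>z. M *v (z :: complex ^ 'k))"
proof (rule bounded_linear_intro[where K = "\<Sum>j\<in>UNIV. norm (column j M)"])
  fix z :: "complex ^ 'k"
  have "norm (M *v z) \<le> (\<Sum>j\<in>UNIV. norm (z $ j *s column j M))"
    unfolding matrix_mult_sum by (rule norm_sum)
  also have "\<dots> \<le> (\<Sum>j\<in>UNIV. norm z * norm (column j M))"
    by (intro sum_mono) (simp add: norm_scale mult_right_mono Finite_Cartesian_Product.norm_nth_le)
  finally show "norm (M *v z) \<le> norm z * (\<Sum>j\<in>UNIV. norm (column j M))"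
    by (simp add: sum_distrib_left)
qed (simp_all add: matrix_vector_right_distrib flip: of_real_scale, simp add: vector_scalar_commute)

text \<open>
  By polarization, preserving the norm is the same as preserving the Hermitian form.
\<close>

definition unitary_matrices :: "(complex ^ 'k ^ 'k) set"
  where "unitary_matrices = {M. \<forall>z. norm (M *v z) = norm z}"

lemma holomorphic_map_on_matrix_vector_mult: "holomorphic_map_on (\<lambda>z. M *v z) S"
  unfolding holomorphic_map_on_def
  by (auto intro!: exI[of _ "\<lambda>z. M *v z"] bounded_linear_imp_has_derivative
      bounded_linear_matrix_vector_mult simp: vector_scalar_commute)

text \<open>
  A norm-preserving matrix is injective, hence invertible, and its inverse preserves the norm.
\<close>

lemma unitary_in_carrier:
  assumes M: "M \<in> unitary_matrices"
  shows "restrict ((*v) M) (ball 0 1) \<in> carrier ball_aut"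
proof -
  have norm_M: "norm (M *v z) = norm z" for z using M by (simp add: unitary_matrices_def)
  have "inj ((*v) M)"
    by (rule injI) (metis norm_M eq_iff_diff_eq_0 matrix_vector_mult_diff_distrib norm_eq_zero)
  then obtain N where NM: "N ** M = mat 1" using matrix_left_invertible_injective by blast
  then have MN: "M ** N = mat 1" using matrix_left_right_inverse by blast
  have inv: "M *v (N *v z) = z" "N *v (M *v z) = z" for z
    by (simp_all add: NM MN matrix_vector_mul_assoc)
  have norm_N: "norm (N *v z) = norm z" for z using norm_M[of "N *v z"] by (simp add: inv)
  show ?thesis
    by (rule restrict_in_carrier_ball_aut[where h = "(*v) N"])
      (simp_all add: holomorphic_map_on_matrix_vector_mult norm_M norm_N inv)
qed

lemma continuous_on_matrix_vector_mult:
  assumes "continuous_on S A" "continuous_on S x"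
  shows "continuous_on S (\<lambda>t. A t *v (x t :: complex ^ 'k) :: complex ^ 'k)"
  unfolding matrix_vector_mult_def
  by (intro continuous_on_vec_lambda continuous_intros assms)

lemma compact_unitary_matrices: "compact (unitary_matrices :: (complex ^ 'k ^ 'k) set)"
proof -
  have "closed {M :: complex ^ 'k ^ 'k. norm (M *v z) = norm z}" for z
    by (intro closed_Collect_eq continuous_on_matrix_vector_mult continuous_intros)
  then have "closed (unitary_matrices :: (complex ^ 'k ^ 'k) set)"
    unfolding unitary_matrices_def by (rule closed_Collect_all)
  moreover have "norm M \<le> (\<Sum>i\<in>(UNIV :: 'k set). \<Sum>j\<in>(UNIV :: 'k set). 1)"
    if M: "M \<in> unitary_matrices" for M :: "complex ^ 'k ^ 'k"
  proof -
    have "norm (M $ i $ j) \<le> 1" for i j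
    proof -
      have "norm (axis j (1 :: complex)) = 1"
        unfolding norm_vec_def L2_set_def axis_def by (simp add: if_distrib[of "\<lambda>c. (norm c)\<^sup>2"] cong: if_cong)
      then have norm_col: "norm (M *v axis j 1) = 1" using M by (simp add: unitary_matrices_def)
      have "M $ i $ j = (M *v axis j 1) $ i"
        by (simp add: matrix_vector_mult_def axis_def if_distrib cong: if_cong)
      also have "norm \<dots> \<le> norm (M *v axis j 1)" by (rule Finite_Cartesian_Product.norm_nth_le)
      finally show ?thesis unfolding norm_col .
    qed
    moreover have "norm M \<le> (\<Sum>i\<in>UNIV. \<Sum>j\<in>UNIV. norm (M $ i $ j))"
      unfolding norm_vec_def
      by (rule order_trans[OF L2_set_le_sum]) (auto intro!: sum_mono L2_set_le_sum)
    ultimately show ?thesis by (meson order_trans sum_mono)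
  qed
  then have "bounded (unitary_matrices :: (complex ^ 'k ^ 'k) set)" by (rule boundedI)
  ultimately show ?thesis by (simp add: compact_eq_bounded_closed)
qed

section \<open>Automorphisms fixing the origin\<close>

text \<open>
  Pairing a holomorphic self-map of the ball, restricted to the complex line spanned by a unit
  vector \<open>u\<close>, with a unit vector \<open>w\<close> gives a holomorphic self-map of the unit disc. This brings
  the one-variable Schwarz lemma to bear on the ball.
\<close>

lemma holomorphic_map_on_along_disc:
  assumes g: "holomorphic_map_on g (ball 0 1)" "\<And>z. norm z < 1 \<Longrightarrow> norm (g z) < 1"
    and u: "norm u = 1" and w: "norm w = 1"
  defines "h \<equiv> \<lambda>l. \<langle>g (l *s u), w\<rangle>"
  shows "h holomorphic_on ball 0 1" "\<And>l. norm l < 1 \<Longrightarrow> norm (h l) < 1"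
    and "(g has_derivative D) (at 0) \<Longrightarrow> deriv h 0 = \<langle>D u, w\<rangle>"
proof -
  have *: "(h has_field_derivative \<langle>D u, w\<rangle>) (at l)"
    if D: "(g has_derivative D) (at (l *s u))" "\<And>c v. D (c *s v) = c *s D v" for D l
  proof -
    have "((\<lambda>l. l *s u) has_derivative (\<lambda>k. k *s u)) (at l)"
      by (intro bounded_linear_imp_has_derivative
          bounded_bilinear.bounded_linear_left[OF bounded_bilinear_scale])
    from has_derivative_compose[OF this D(1)]
    have "(h has_derivative (\<lambda>k. \<langle>D (k *s u), w\<rangle>)) (at l)"
      unfolding h_def by (rule bounded_linear.has_derivative[OF bounded_linear_hermitian_form])
    then show ?thesis
      unfolding has_field_derivative_def D(2) hermitian_form_simps by (simp add: mult_commute_abs)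
  qed
  show "h holomorphic_on ball 0 1"
    unfolding holomorphic_on_open[OF open_ball]
  proof
    fix l :: complex assume "l \<in> ball 0 1"
    then have "l *s u \<in> ball 0 1" using u by (simp add: norm_scale)
    then show "\<exists>f'. (h has_field_derivative f') (at l)"
      using g(1) * unfolding holomorphic_map_on_def by blast
  qed
  show "norm (h l) < 1" if "norm l < 1" for l
    unfolding h_def using that u w by (intro norm_hermitian_form_less_1 g(2)) (simp_all add: norm_scale)
  assume D: "(g has_derivative D) (at 0)"
  obtain D' where D': "(g has_derivative D') (at 0)" "\<And>c v. D' (c *s v) = c *s D' v"
    using g(1) by (force simp: holomorphic_map_on_def)
  have "D = D'" using has_derivative_unique D D'(1) by blast
  with * D' show "deriv h 0 = \<langle>D u, w\<rangle>"
    by (intro DERIV_imp_deriv) simp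
qed

text \<open>
  Take \<open>u\<close> and \<open>w\<close> to be the unit vectors in the directions of \<open>z\<close> and \<open>g z\<close>; the resulting
  self-map of the disc sends \<open>|z|\<close> to \<open>|g z|\<close>.
\<close>

lemma Schwarz_lemma_ball:
  assumes g: "holomorphic_map_on g (ball 0 1)" "\<And>z. norm z < 1 \<Longrightarrow> norm (g z) < 1"
    and g0: "g 0 = 0" and z: "norm z < 1"
  shows "norm (g z) \<le> norm z"
proof (cases "z = 0 \<or> g z = 0")
  case True then show ?thesis using g0 by auto
next
  case False
  define u where "u = complex_of_real (inverse (norm z)) *s z"
  define w where "w = complex_of_real (inverse (norm (g z))) *s g z"
  have uw: "norm u = 1" "norm w = 1"
    using False by (simp_all add: u_def w_def norm_scale norm_inverse)
  let ?h = "\<lambda>l. \<langle>g (l *s u), w\<rangle>"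
  have zu: "complex_of_real (norm z) *s u = z" using False by (simp add: u_def)
  have "norm (?h (complex_of_real (norm z))) \<le> norm (complex_of_real (norm z))"
    by (rule Schwarz_Lemma(1))
      (use holomorphic_map_on_along_disc[OF g uw] z g0 in auto)
  moreover have "?h (complex_of_real (norm z)) = complex_of_real (norm (g z))"
    using False unfolding zu by (simp add: w_def hermitian_form_simps hermitian_form_self power2_eq_square)
  ultimately show ?thesis by simp
qed

text \<open>
  The Schwarz lemma applies to the automorphism and to its inverse.
\<close>

lemma ball_aut_fixing_0_norm:
  assumes g: "g \<in> carrier ball_aut" and g0: "g 0 = 0" and z: "norm z < 1"
  shows "norm (g z) = norm z"
proof (rule antisym)
  let ?k = "inv\<^bsub>ball_aut\<^esub> g"
  interpret group ball_aut by (rule group_ball_aut)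
  have k: "?k \<in> carrier ball_aut" using g by simp
  show "norm (g z) \<le> norm z"
    by (rule Schwarz_lemma_ball) (use g g0 z carrier_ball_autD(1) ball_aut_in_ball in auto)
  have "?k 0 = 0" using ball_aut_inv_apply(2)[OF g, of 0] g0 by simp
  then have "norm (?k (g z)) \<le> norm (g z)"
    by (intro Schwarz_lemma_ball) (use k carrier_ball_autD(1) ball_aut_in_ball[OF g z] ball_aut_in_ball in auto)
  then show "norm z \<le> norm (g z)" by (simp add: ball_aut_inv_apply(2)[OF g z])
qed

text \<open>
  Cartan's theorem for the ball: an automorphism fixing the origin agrees with its derivative
  \<open>D\<close> there. As \<open>g\<close> preserves the norm, so does \<open>D\<close>. For a unit vector \<open>u\<close>, the self-map
  \<open>l \<mapsto> \<langle>g (l u), D u\<rangle>\<close> of the disc has derivative \<open>|D u|^2 = 1\<close> at \<open>0\<close>, so it is the identity by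
  the equality case of the Schwarz lemma. Then \<open>\<langle>g z, D z\<rangle> = |z|^2 = |g z| |D z|\<close> for \<open>z = l u\<close>, which
  forces \<open>g z = D z\<close>.
\<close>

lemma ball_aut_fixing_0_unitary:
  fixes g :: "complex ^ 'k \<Rightarrow> complex ^ 'k"
  assumes g: "g \<in> carrier ball_aut" and g0: "g 0 = 0"
  obtains M where "M \<in> unitary_matrices" "\<And>z. norm z < 1 \<Longrightarrow> g z = M *v z"
proof -
  have hol: "holomorphic_map_on g (ball 0 1)" and less: "\<And>z. norm z < 1 \<Longrightarrow> norm (g z) < 1"
    using g carrier_ball_autD(1) ball_aut_in_ball by auto
  obtain D where D: "(g has_derivative D) (at 0)" "\<And>c v. D (c *s v) = c *s D v"
    using hol by (force simp: holomorphic_map_on_def)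
  have linD: "linear D" using D(1) has_derivative_linear by blast
  have unit: "norm (D u) = 1" if u: "norm u = 1" for u
  proof -
    have "((\<lambda>t :: real. t *\<^sub>R u) has_derivative (\<lambda>t. t *\<^sub>R u)) (at 0)"
      by (auto intro!: derivative_eq_intros)
    from has_derivative_compose[OF this, of g D] D(1)
    have "((\<lambda>t. g (t *\<^sub>R u)) has_vector_derivative D u) (at 0)"
      by (simp add: has_vector_derivative_def linear_scale[OF linD])
    then have "((\<lambda>t. norm (g (t *\<^sub>R u) - g 0 - t *\<^sub>R D u) / norm t) \<longlongrightarrow> 0) (at 0)"
      by (simp add: has_vector_derivative_def has_derivative_iff_norm)
    moreover have "\<bar>1 - norm (D u)\<bar> \<le> norm (g (t *\<^sub>R u) - g 0 - t *\<^sub>R D u) / norm t"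
      if t: "t \<noteq> 0" "\<bar>t\<bar> < 1" for t
    proof -
      have "norm (g (t *\<^sub>R u)) = \<bar>t\<bar>"
        using ball_aut_fixing_0_norm[OF g g0, of "t *\<^sub>R u"] t u by simp
      then have "\<bar>\<bar>t\<bar> - \<bar>t\<bar> * norm (D u)\<bar> \<le> norm (g (t *\<^sub>R u) - g 0 - t *\<^sub>R D u)"
        using norm_triangle_ineq3[of "g (t *\<^sub>R u)" "t *\<^sub>R D u"] g0 by simp
      moreover have "\<bar>\<bar>t\<bar> - \<bar>t\<bar> * norm (D u)\<bar> = \<bar>1 - norm (D u)\<bar> * \<bar>t\<bar>"
        by (metis abs_abs abs_mult mult.commute mult.right_neutral right_diff_distrib)
      ultimately show ?thesis using t by (simp add: pos_le_divide_eq)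
    qed
    then have "\<forall>\<^sub>F t in at (0::real). \<bar>1 - norm (D u)\<bar> \<le> norm (g (t *\<^sub>R u) - g 0 - t *\<^sub>R D u) / norm t"
      unfolding eventually_at by (intro exI[of _ 1]) auto
    ultimately have "\<bar>1 - norm (D u)\<bar> \<le> 0"
      by (rule tendsto_lowerbound) simp
    then show ?thesis by simp
  qed
  have norm_D: "norm (D z) = norm z" for z
  proof (cases "z = 0")
    case False
    then have "norm (D (z /\<^sub>R norm z)) = 1" by (intro unit) simp
    then show ?thesis using False by (simp add: linear_scale[OF linD] field_simps)
  qed (simp add: linear_0[OF linD])
  have g_eq: "g z = D z" if z: "norm z < 1" for z
  proof (cases "z = 0")
    case False
    define u where "u = complex_of_real (inverse (norm z)) *s z"
    define l where "l = complex_of_real (norm z)"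
    have u: "norm u = 1" and l: "norm l < 1"
      using False z by (simp_all add: u_def l_def norm_scale norm_inverse)
    have zu: "l *s u = z" using False by (simp add: u_def l_def)
    let ?h = "\<lambda>l. \<langle>g (l *s u), D u\<rangle>"
    note h = holomorphic_map_on_along_disc[OF hol less u unit[OF u]]
    have h': "deriv ?h 0 = 1" using h(3)[OF _ D(1)] unit[OF u] by (simp add: hermitian_form_self)
    have "\<exists>\<alpha>. (\<forall>z. norm z < 1 \<longrightarrow> ?h z = \<alpha> * z) \<and> norm \<alpha> = 1"
      by (rule Schwarz_Lemma(3)[where \<xi> = 0]) (use h h' g0 in auto)
    then obtain \<alpha> where \<alpha>: "\<And>z. norm z < 1 \<Longrightarrow> ?h z = \<alpha> * z" by blast
    have "(?h has_field_derivative \<alpha>) (at 0)"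
      by (rule has_field_derivative_transform_within[where f = "\<lambda>z. \<alpha> * z" and d = 1])
       (auto intro!: derivative_eq_intros simp: \<alpha>)
    then have "\<alpha> = 1" using h' DERIV_imp_deriv by metis
    then have inn: "\<langle>g z, D u\<rangle> = l" using \<alpha>[OF l] by (simp add: zu)
    have Dz: "D z = l *s D u" using D(2) zu by metis
    then have "\<langle>g z, D z\<rangle> = complex_of_real ((norm z)\<^sup>2)"
      by (simp add: hermitian_form_simps inn) (simp add: l_def power2_eq_square)
    moreover from this have "\<langle>D z, g z\<rangle> = complex_of_real ((norm z)\<^sup>2)"
      by (metis cnj_hermitian_form complex_cnj_complex_of_real)
    ultimately have "\<langle>g z - D z, g z - D z\<rangle> = 0"
      unfolding hermitian_form_simps
      by (simp add: hermitian_form_self norm_D ball_aut_fixing_0_norm[OF g g0 z])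
    then have "complex_of_real ((norm (g z - D z))\<^sup>2) = 0"
      by (simp only: hermitian_form_self)
    then show ?thesis by simp
  qed (simp add: g0 linear_0[OF linD])
  have "Vector_Spaces.linear (*s) (*s) D"
    by unfold_locales (simp_all add: linear_add[OF linD] D(2) algebra_simps)
  then have "matrix D *v z = D z" for z by (rule matrix_works)
  then show thesis using that[of "matrix D"] norm_D g_eq by (simp add: unitary_matrices_def)
qed

section \<open>Proper action on the ball\<close>

lemma topspace_ball_aut_topology: "topspace ball_aut_topology = carrier ball_aut"
  by (auto simp: ball_aut_topology_def PiE_def dest: carrier_ball_autD(3) ball_aut_in_ball)

lemma continuous_map_ball_aut_eval:
  assumes "norm z < 1"
  shows "continuous_map ball_aut_topology (top_of_set (ball 0 1)) (\<lambda>g. g z)"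
  unfolding ball_aut_topology_def using assms
  by (intro continuous_map_from_subtopology continuous_map_product_projection) simp

lemma continuous_map_into_ball_aut:
  assumes carrier: "\<And>x. x \<in> S \<Longrightarrow> F x \<in> carrier ball_aut"
    and cont: "\<And>z. norm z < 1 \<Longrightarrow> continuous_on S (\<lambda>x. F x z)"
  shows "continuous_map (top_of_set S) ball_aut_topology F"
  unfolding ball_aut_topology_def continuous_map_in_subtopology continuous_map_componentwise
  using carrier cont carrier_ball_autD(3)[OF carrier] ball_aut_in_ball[OF carrier]
  by (auto simp: continuous_map_in_subtopology)

text \<open>
  The automorphism group acts properly on the ball. An automorphism \<open>g\<close> with \<open>g p = a\<close> has the
  form \<open>\<tau>\<^sub>a \<circ> M \<circ> \<tau>\<^sub>-\<^sub>p\<close>, where \<open>\<tau>\<close> denotes the ball translations and \<open>M\<close> is unitary, because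
  \<open>\<tau>\<^sub>-\<^sub>a \<circ> g \<circ> \<tau>\<^sub>p\<close> fixes the origin. Hence the automorphisms moving \<open>p\<close> into \<open>K\<close> are the continuous
  image of the compact set of pairs \<open>(M, a)\<close> with \<open>M\<close> unitary and \<open>a \<in> K\<close>.
\<close>

lemma compactin_ball_aut_eval:
  fixes p :: "complex ^ 'k"
  assumes p: "norm p < 1" and K: "compact K" "K \<subseteq> ball 0 1"
  shows "compactin ball_aut_topology {g \<in> carrier ball_aut. g p \<in> K}"
proof -
  define F :: "(complex ^ 'k ^ 'k) \<times> (complex ^ 'k) \<Rightarrow> complex ^ 'k \<Rightarrow> complex ^ 'k"
    where "F = (\<lambda>(M, a). \<lambda>z\<in>ball 0 1. ball_translation a (M *v ball_translation (- p) z))"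
  let ?S = "(unitary_matrices :: (complex ^ 'k ^ 'k) set) \<times> K"
  interpret group ball_aut by (rule group_ball_aut)
  have np: "norm (- p) < 1" using p by simp
  have norm_K: "norm a < 1" if "a \<in> K" for a using K that by auto
  have F_carrier: "F x \<in> carrier ball_aut" if S: "x \<in> ?S" for x
  proof -
    obtain M a where x: "x = (M, a)" "M \<in> unitary_matrices" "a \<in> K" using S by auto
    let ?r = "\<lambda>g. restrict g (ball (0 :: complex ^ 'k) 1)"
    have c: "?r (ball_translation a) \<in> carrier ball_aut" "?r ((*v) M) \<in> carrier ball_aut"
      "?r (ball_translation (- p)) \<in> carrier ball_aut"
      using x norm_K np by (simp_all add: unitary_in_carrier ball_translation_in_carrier)
    have "F x z = (?r (ball_translation a) \<otimes>\<^bsub>ball_aut\<^esub> (?r ((*v) M) \<otimes>\<^bsub>ball_aut\<^esub> ?r (ball_translation (- p)))) z" for z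
    proof (cases "norm z < 1")
      case True
      then show ?thesis
        using c x by (simp add: mult_ball_aut_apply F_def unitary_matrices_def
            norm_ball_translation_less_1[OF _ np])
    next
      case False
      have "?r (ball_translation a) \<otimes>\<^bsub>ball_aut\<^esub> (?r ((*v) M) \<otimes>\<^bsub>ball_aut\<^esub> ?r (ball_translation (- p)))
          \<in> extensional (ball 0 1)"
        using c by (intro carrier_ball_autD(3)) simp
      then show ?thesis using False x by (simp add: F_def extensional_def)
    qed
    then have "F x = ?r (ball_translation a) \<otimes>\<^bsub>ball_aut\<^esub> (?r ((*v) M) \<otimes>\<^bsub>ball_aut\<^esub> ?r (ball_translation (- p)))"
      by blast
    then show ?thesis using c by simp
  qed
  have "continuous_map (top_of_set ?S) ball_aut_topology F"
  proof (rule continuous_map_into_ball_aut[OF F_carrier])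
    fix z :: "complex ^ 'k" assume z: "norm z < 1"
    have "norm (ball_translation (- p) z) < 1" by (rule norm_ball_translation_less_1[OF z np])
    then have "continuous_on ?S (\<lambda>x. ball_translation (snd x) (fst x *v ball_translation (- p) z))"
      by (intro continuous_on_ball_translation continuous_on_matrix_vector_mult continuous_intros)
        (auto simp: norm_K unitary_matrices_def)
    then show "continuous_on ?S (\<lambda>x. F x z)"
      using z by (simp add: F_def case_prod_unfold)
  qed
  moreover have "compactin (top_of_set ?S) ?S"
    by (simp add: compactin_subtopology compact_Times compact_unitary_matrices K)
  ultimately have "compactin ball_aut_topology (F ` ?S)" by (rule image_compactin[rotated])
  moreover have "{g \<in> carrier ball_aut. g p \<in> K} = F ` ?S"
  proof (intro subset_antisym subsetI)
    fix g assume "g \<in> F ` ?S"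
    then obtain M a where x: "g = F (M, a)" "M \<in> unitary_matrices" "a \<in> K" by auto
    have "ball_translation (- p) p = 0"
      using ball_translation_minus[of 0 p] p by (simp add: ball_translation_0)
    then have "g p = a" using x p norm_K by (simp add: F_def ball_translation_0)
    then show "g \<in> {g \<in> carrier ball_aut. g p \<in> K}" using x F_carrier by auto
  next
    fix g assume "g \<in> {g \<in> carrier ball_aut. g p \<in> K}"
    then have g: "g \<in> carrier ball_aut" and K: "g p \<in> K" by auto
    then have gp: "norm (g p) < 1" "norm (- g p) < 1" using norm_K by auto
    let ?r = "\<lambda>g. restrict g (ball (0 :: complex ^ 'k) 1)"
    let ?t = "ball_translation (- g p)"
    define k where "k = ?r ?t \<otimes>\<^bsub>ball_aut\<^esub> (g \<otimes>\<^bsub>ball_aut\<^esub> ?r (ball_translation p))"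
    have c: "?r ?t \<in> carrier ball_aut" "?r (ball_translation p) \<in> carrier ball_aut"
      using gp p by (simp_all only: ball_translation_in_carrier)
    have k: "k \<in> carrier ball_aut" using c g by (simp add: k_def)
    have k_apply: "k z = ?t (g (ball_translation p z))" if "norm z < 1" for z
      using that c g p by (simp add: k_def mult_ball_aut_apply norm_ball_translation_less_1 ball_aut_in_ball)
    have "?t (g p) = 0"
      using ball_translation_minus[of 0 "g p"] gp by (simp add: ball_translation_0)
    then have "k 0 = 0" using k_apply[of 0] p by (simp add: ball_translation_0)
    then obtain M where M: "M \<in> unitary_matrices" "\<And>z. norm z < 1 \<Longrightarrow> k z = M *v z"
      using ball_aut_fixing_0_unitary[OF k] by blast
    have "F (M, g p) z = g z" for z
    proof (cases "norm z < 1")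
      case True
      let ?y = "ball_translation (- p) z"
      have y: "norm ?y < 1" by (rule norm_ball_translation_less_1[OF True np])
      have "M *v ?y = ?t (g z)"
        using M(2)[OF y] k_apply[OF y] ball_translation_minus'[OF True p] by simp
      then show ?thesis
        using True gp ball_translation_minus'[OF ball_aut_in_ball[OF g True] gp(1)] by (simp add: F_def)
    qed (use carrier_ball_autD(3)[OF g] in \<open>auto simp: F_def extensional_def\<close>)
    then have "g = F (M, g p)" by auto
    then show "g \<in> F ` ?S" using M(1) K by blast
  qed
  ultimately show ?thesis by simp
qed

section \<open>Projecting a coincidence set\<close>

text \<open>
  The coincidence set of the families \<open>u\<close> and \<open>v\<close> is closed in \<open>X \<times> Y\<close>. Projecting a closed set
  to \<open>X\<close> along a compact factor gives a closed set, and by the last hypothesis only a compact part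
  of \<open>Y\<close> matters near each point of \<open>X\<close>. Working with projections instead of limits of sequences
  avoids any countability assumption on the topologies.
\<close>

lemma closedin_fst_coincidence:
  assumes Z: "\<And>i. i \<in> I \<Longrightarrow> Hausdorff_space (Z i)"
    and u: "\<And>i. i \<in> I \<Longrightarrow> continuous_map X (Z i) (u i)"
    and v: "\<And>i. i \<in> I \<Longrightarrow> continuous_map Y (Z i) (v i)"
    and proper: "\<And>x. x \<in> topspace X \<Longrightarrow> \<exists>W C. openin X W \<and> x \<in> W \<and> compactin Y C \<and>
        (\<forall>x'\<in>W. \<forall>y\<in>topspace Y. (\<forall>i\<in>I. u i x' = v i y) \<longrightarrow> y \<in> C)"
  shows "closedin X {x \<in> topspace X. \<exists>y\<in>topspace Y. \<forall>i\<in>I. u i x = v i y}" (is "closedin X ?E")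
proof -
  have "openin X (topspace X - ?E)"
    unfolding openin_subopen[of X "topspace X - ?E"]
  proof
    fix x assume x: "x \<in> topspace X - ?E"
    then obtain W C where W: "openin X W" "x \<in> W" and C: "compactin Y C"
      and WC: "\<And>x' y. x' \<in> W \<Longrightarrow> y \<in> topspace Y \<Longrightarrow> (\<forall>i\<in>I. u i x' = v i y) \<Longrightarrow> y \<in> C"
      using proper by (metis (no_types, lifting) DiffD1)
    let ?P = "prod_topology X (subtopology Y C)"
    define R where "R = {p \<in> topspace ?P. \<forall>i\<in>I. u i (fst p) = v i (snd p)}"
    have cl: "closedin ?P {p \<in> topspace ?P. u i (fst p) = v i (snd p)}" if "i \<in> I" for i
    proof (rule closedin_continuous_maps_eq[OF Z[OF that]])
      show "continuous_map ?P (Z i) (\<lambda>p. u i (fst p))"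
        using continuous_map_compose[OF continuous_map_fst u[OF that]] by (simp add: o_def)
      show "continuous_map ?P (Z i) (\<lambda>p. v i (snd p))"
        using continuous_map_compose[OF continuous_map_snd continuous_map_from_subtopology[OF v[OF that]]]
        by (simp add: o_def)
    qed
    have "closedin ?P R"
    proof (cases "I = {}")
      case True
      then have "R = topspace ?P" unfolding R_def by blast
      then show ?thesis by (simp only: closedin_topspace)
    next
      case False
      then have "R = (\<Inter>i\<in>I. {p \<in> topspace ?P. u i (fst p) = v i (snd p)})"
        unfolding R_def by blast
      moreover have "closedin ?P \<dots>" using False cl by (rule closedin_INT)
      ultimately show ?thesis by (rule ssubst)
    qed
    moreover have "closed_map ?P X fst"
      by (rule Abstract_Topological_Spaces.closed_map_fst) (simp add: C compact_space_subtopology)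
    ultimately have cl: "closedin X (fst ` R)" by (simp add: closed_map_def)
    have "x \<notin> fst ` R" using x by (auto simp: R_def)
    \<comment> \<open>On \<open>W\<close>, a partner \<open>y\<close> lies in \<open>C\<close>, so \<open>?E\<close> agrees with the closed set \<open>fst ` R\<close> there.\<close>
    moreover have "(W - fst ` R) \<inter> ?E = {}"
    proof -
      have "x' \<in> fst ` R" if "x' \<in> W" "x' \<in> topspace X" "y \<in> topspace Y" "\<forall>i\<in>I. u i x' = v i y" for x' y
        using WC[of x' y] that by (intro image_eqI[of _ _ "(x', y)"]) (auto simp: R_def)
      then show ?thesis by blast
    qed
    ultimately show "\<exists>T. openin X T \<and> x \<in> T \<and> T \<subseteq> topspace X - ?E"
      using W openin_subset[OF W(1)] by (intro exI[of _ "W - fst ` R"]) (auto intro: openin_diff cl)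
  qed
  then show ?thesis by (simp add: closedin_def) 
qed

section \<open>The groups of a proper holomorphic map\<close>

lemma
  fixes f :: "complex ^ 'n \<Rightarrow> complex ^ 'm"
  assumes f: "f \<in> ball 0 1 \<rightarrow> ball 0 1"
  shows subgroup_source_group: "subgroup \<Gamma>\<^bsub>f\<^esub> ball_aut"
    and subgroup_target_group: "subgroup T\<^bsub>f\<^esub> ball_aut"
proof -
  interpret S: group "ball_aut :: (complex ^ 'n \<Rightarrow> complex ^ 'n) monoid" by (rule group_ball_aut)
  interpret T: group "ball_aut :: (complex ^ 'm \<Rightarrow> complex ^ 'm) monoid" by (rule group_ball_aut)
  have one: "(\<one>\<^bsub>ball_aut\<^esub>, \<one>\<^bsub>ball_aut\<^esub>) \<in> A\<^bsub>f\<^esub>"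
    using f S.one_closed T.one_closed by (auto simp: equivariance_group_def one_ball_aut)
  have mult: "(g \<otimes>\<^bsub>ball_aut\<^esub> g', h \<otimes>\<^bsub>ball_aut\<^esub> h') \<in> A\<^bsub>f\<^esub>"
    if "(g, h) \<in> A\<^bsub>f\<^esub>" "(g', h') \<in> A\<^bsub>f\<^esub>" for g g' h h'
    using that f ball_aut_in_ball[of g']
    by (auto simp: equivariance_group_def mult_ball_aut_apply Pi_iff)
  have inv: "(inv\<^bsub>ball_aut\<^esub> g, inv\<^bsub>ball_aut\<^esub> h) \<in> A\<^bsub>f\<^esub>" if "(g, h) \<in> A\<^bsub>f\<^esub>" for g h
  proof -
    have gh: "g \<in> carrier ball_aut" "h \<in> carrier ball_aut" "\<And>z. norm z < 1 \<Longrightarrow> f (g z) = h (f z)"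
      using that by (auto simp: equivariance_group_def)
    have "f ((inv\<^bsub>ball_aut\<^esub> g) z) = (inv\<^bsub>ball_aut\<^esub> h) (f z)" if z: "norm z < 1" for z
    proof -
      let ?w = "(inv\<^bsub>ball_aut\<^esub> g) z"
      have w: "norm ?w < 1" using ball_aut_in_ball[OF _ z] gh(1) by simp
      have "(inv\<^bsub>ball_aut\<^esub> h) (f z) = (inv\<^bsub>ball_aut\<^esub> h) (h (f ?w))"
        using gh(3)[OF w] ball_aut_inv_apply(1)[OF gh(1) z] by simp
      also have "\<dots> = f ?w"
        using f w by (intro ball_aut_inv_apply(2)[OF gh(2)]) (auto simp: Pi_iff)
      finally show ?thesis ..
    qed
    then show ?thesis using gh by (simp add: equivariance_group_def)
  qed
  show "subgroup \<Gamma>\<^bsub>f\<^esub> ball_aut"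
  proof (rule S.subgroupI)
    show "\<Gamma>\<^bsub>f\<^esub> \<subseteq> carrier ball_aut" by (auto simp: source_group_def equivariance_group_def)
    show "\<Gamma>\<^bsub>f\<^esub> \<noteq> {}" using one by (auto simp: source_group_def)
  qed (use mult inv in \<open>force simp: source_group_def\<close>)+
  show "subgroup T\<^bsub>f\<^esub> ball_aut"
  proof (rule T.subgroupI)
    show "T\<^bsub>f\<^esub> \<subseteq> carrier ball_aut" by (auto simp: target_group_def equivariance_group_def)
    show "T\<^bsub>f\<^esub> \<noteq> {}" using one by (auto simp: target_group_def)
  qed (use mult inv in \<open>force simp: target_group_def\<close>)+
qed

lemma proper_holomorphicD:
  assumes "proper_holomorphic f"
  shows "f \<in> ball 0 1 \<rightarrow> ball 0 1"
    and "continuous_map (top_of_set (ball 0 1)) (top_of_set (ball 0 1)) f"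
    and "\<And>K. compact K \<Longrightarrow> K \<subseteq> ball 0 1 \<Longrightarrow> compact {z \<in> ball 0 1. f z \<in> K}"
  using assms holomorphic_map_on_imp_continuous_on[of f "ball 0 1"]
  unfolding proper_holomorphic_iff_compact_preimages by auto

text \<open>
  If \<open>\<gamma>'\<close> is close to \<open>\<gamma>\<close>, then \<open>f (\<gamma>' 0)\<close> stays in a ball of radius \<open>r < 1\<close>. Any \<open>\<psi>\<close> with
  \<open>f \<circ> \<gamma>' = \<psi> \<circ> f\<close> then moves \<open>f 0\<close> into that ball, which confines \<open>\<psi>\<close> to a compact set.
\<close>

lemma closedin_source_group:
  fixes f :: "complex ^ 'n \<Rightarrow> complex ^ 'm"
  assumes f: "proper_holomorphic f"
  shows "closedin ball_aut_topology \<Gamma>\<^bsub>f\<^esub>"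
proof -
  note D = proper_holomorphicD[OF f]
  have fz: "norm (f z) < 1" if "norm z < 1" for z using D(1) that by (auto simp: Pi_iff)
  have cont: "continuous_map ball_aut_topology (top_of_set (ball 0 1)) (\<lambda>\<gamma>. f (\<gamma> z))" if "norm z < 1" for z
    using continuous_map_compose[OF continuous_map_ball_aut_eval[OF that] D(2)] by (simp add: o_def)
  have "closedin ball_aut_topology {\<gamma> \<in> topspace ball_aut_topology.
      \<exists>\<psi>\<in>topspace ball_aut_topology. \<forall>z\<in>ball 0 1. f (\<gamma> z) = \<psi> (f z)}"
  proof (rule closedin_fst_coincidence[where Z = "\<lambda>_. top_of_set (ball 0 1)"])
    fix \<gamma> :: "complex ^ 'n \<Rightarrow> complex ^ 'n" assume "\<gamma> \<in> topspace ball_aut_topology"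
    then have \<gamma>: "\<gamma> \<in> carrier ball_aut" by (simp add: topspace_ball_aut_topology)
    then have "norm (f (\<gamma> 0)) < 1" by (intro fz ball_aut_in_ball[OF \<gamma>]) simp
    then obtain r where r: "norm (f (\<gamma> 0)) < r" "r < 1" by (meson dense)
    let ?W = "{\<gamma> \<in> topspace ball_aut_topology. f (\<gamma> 0) \<in> ball 0 1 \<inter> ball 0 r}"
    let ?C = "{\<psi> \<in> carrier ball_aut. \<psi> (f 0) \<in> cball 0 r}"
    have "openin ball_aut_topology ?W"
      by (rule openin_continuous_map_preimage[OF cont]) (auto simp: openin_open)
    moreover have "compactin ball_aut_topology ?C"
      using r by (intro compactin_ball_aut_eval fz) auto
    moreover have "\<psi> \<in> ?C"
      if "\<gamma>' \<in> ?W" "\<psi> \<in> carrier ball_aut" "\<forall>z\<in>ball 0 1. f (\<gamma>' z) = \<psi> (f z)" for \<gamma>' \<psi>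
    proof -
      have "f (\<gamma>' 0) = \<psi> (f 0)" using that(3) by simp
      then show ?thesis using that(1,2) by simp
    qed
    ultimately show "\<exists>W C. openin ball_aut_topology W \<and> \<gamma> \<in> W \<and> compactin ball_aut_topology C \<and>
        (\<forall>\<gamma>'\<in>W. \<forall>\<psi>\<in>topspace ball_aut_topology. (\<forall>z\<in>ball 0 1. f (\<gamma>' z) = \<psi> (f z)) \<longrightarrow> \<psi> \<in> C)"
      using r \<gamma> by (intro exI[of _ ?W] exI[of _ ?C] conjI ballI impI)
        (simp_all add: topspace_ball_aut_topology)
  qed (use cont fz continuous_map_ball_aut_eval in \<open>auto intro: Hausdorff_space_subtopology\<close>)
  also have "{\<gamma> \<in> topspace ball_aut_topology. \<exists>\<psi>\<in>topspace ball_aut_topology. \<forall>z\<in>ball 0 1. f (\<gamma> z) = \<psi> (f z)} = \<Gamma>\<^bsub>f\<^esub>"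
    by (force simp: source_group_def equivariance_group_def topspace_ball_aut_topology)
  finally show ?thesis .
qed

text \<open>
  Here properness of \<open>f\<close> enters: if \<open>\<psi>' (f 0) = f (\<gamma> 0)\<close> stays in a ball of radius \<open>r < 1\<close>, then
  \<open>\<gamma> 0\<close> stays in the preimage of that ball, which is compact, and this confines \<open>\<gamma>\<close>.
\<close>

lemma closedin_target_group:
  fixes f :: "complex ^ 'n \<Rightarrow> complex ^ 'm"
  assumes f: "proper_holomorphic f"
  shows "closedin ball_aut_topology T\<^bsub>f\<^esub>"
proof -
  note D = proper_holomorphicD[OF f]
  have fz: "norm (f z) < 1" if "norm z < 1" for z using D(1) that by (auto simp: Pi_iff)
  have cont: "continuous_map ball_aut_topology (top_of_set (ball 0 1)) (\<lambda>\<gamma>. f (\<gamma> z))" if "norm z < 1" for z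
    using continuous_map_compose[OF continuous_map_ball_aut_eval[OF that] D(2)] by (simp add: o_def)
  have "closedin ball_aut_topology {\<psi> \<in> topspace ball_aut_topology.
      \<exists>\<gamma>\<in>topspace ball_aut_topology. \<forall>z\<in>ball 0 1. \<psi> (f z) = f (\<gamma> z)}"
  proof (rule closedin_fst_coincidence[where Z = "\<lambda>_. top_of_set (ball 0 1)"])
    fix \<psi> :: "complex ^ 'm \<Rightarrow> complex ^ 'm" assume "\<psi> \<in> topspace ball_aut_topology"
    then have \<psi>: "\<psi> \<in> carrier ball_aut" by (simp add: topspace_ball_aut_topology)
    then have "norm (\<psi> (f 0)) < 1" by (intro ball_aut_in_ball[OF \<psi>] fz) simp
    then obtain r where r: "norm (\<psi> (f 0)) < r" "r < 1" by (meson dense)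
    let ?W = "{\<psi> \<in> topspace ball_aut_topology. \<psi> (f 0) \<in> ball 0 1 \<inter> ball 0 r}"
    let ?C = "{\<gamma> \<in> carrier ball_aut. \<gamma> 0 \<in> {z \<in> ball 0 1. f z \<in> cball 0 r}}"
    have "openin ball_aut_topology ?W"
      by (rule openin_continuous_map_preimage[OF continuous_map_ball_aut_eval[OF fz]]) (auto simp: openin_open)
    moreover have "compactin ball_aut_topology ?C"
      using r by (intro compactin_ball_aut_eval D(3)) auto
    moreover have "\<gamma> \<in> ?C"
      if "\<psi>' \<in> ?W" "\<gamma> \<in> carrier ball_aut" "\<forall>z\<in>ball 0 1. \<psi>' (f z) = f (\<gamma> z)" for \<psi>' \<gamma>
    proof -
      have "\<psi>' (f 0) = f (\<gamma> 0)" using that(3) by simp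
      then show ?thesis using that(1,2) ball_aut_in_ball[OF that(2), of 0] by simp
    qed
    ultimately show "\<exists>W C. openin ball_aut_topology W \<and> \<psi> \<in> W \<and> compactin ball_aut_topology C \<and>
        (\<forall>\<psi>'\<in>W. \<forall>\<gamma>\<in>topspace ball_aut_topology. (\<forall>z\<in>ball 0 1. \<psi>' (f z) = f (\<gamma> z)) \<longrightarrow> \<gamma> \<in> C)"
      using r \<psi> by (intro exI[of _ ?W] exI[of _ ?C] conjI ballI impI)
        (simp_all add: topspace_ball_aut_topology)
  qed (use cont fz continuous_map_ball_aut_eval in \<open>auto intro: Hausdorff_space_subtopology\<close>)
  also have "{\<psi> \<in> topspace ball_aut_topology. \<exists>\<gamma>\<in>topspace ball_aut_topology. \<forall>z\<in>ball 0 1. \<psi> (f z) = f (\<gamma> z)} = T\<^bsub>f\<^esub>"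
    by (force simp: target_group_def equivariance_group_def topspace_ball_aut_topology)
  finally show ?thesis .
qed

text \<open>
  The orbits of \<open>f 0\<close> under \<open>T\<^bsub>f\<^esub>\<close> and of \<open>0\<close> under \<open>\<Gamma>\<^bsub>f\<^esub>\<close> correspond under \<open>f\<close>. If one group is
  compact, so is its orbit, hence the image or the preimage of that orbit under \<open>f\<close>; the
  other group is then a closed set of automorphisms moving a point into a compact set.
\<close>

lemma compactin_source_group_iff_target_group:
  fixes f :: "complex ^ 'n \<Rightarrow> complex ^ 'm"
  assumes f: "proper_holomorphic f"
  shows "compactin ball_aut_topology \<Gamma>\<^bsub>f\<^esub> \<longleftrightarrow> compactin ball_aut_topology T\<^bsub>f\<^esub>"
proof -
  note D = proper_holomorphicD[OF f]
  have z0: "norm (0 :: complex ^ 'n) < 1" by simp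
  have f0: "norm (f 0) < 1" using D(1) by (auto simp: Pi_iff)
  have target: "compactin ball_aut_topology T\<^bsub>f\<^esub>" if "compactin ball_aut_topology \<Gamma>\<^bsub>f\<^esub>"
  proof -
    let ?K = "(f \<circ> (\<lambda>\<gamma>. \<gamma> 0)) ` \<Gamma>\<^bsub>f\<^esub>"
    have "compactin (top_of_set (ball 0 1)) ?K"
      using that continuous_map_compose[OF continuous_map_ball_aut_eval[OF z0] D(2)]
      by (rule image_compactin)
    then have K: "compact ?K" "?K \<subseteq> ball 0 1"
      by (simp_all add: compactin_subtopology)
    have "\<exists>\<gamma>\<in>\<Gamma>\<^bsub>f\<^esub>. \<psi> \<in> carrier ball_aut \<and> \<psi> (f 0) = (f \<circ> (\<lambda>\<gamma>. \<gamma> 0)) \<gamma>" if "\<psi> \<in> T\<^bsub>f\<^esub>" for \<psi>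
      using that by (fastforce simp: target_group_def source_group_def equivariance_group_def)
    then have "T\<^bsub>f\<^esub> \<subseteq> {\<psi> \<in> carrier ball_aut. \<psi> (f 0) \<in> ?K}" by blast
    then show ?thesis
      by (rule closed_compactin[OF compactin_ball_aut_eval[OF f0 K] _ closedin_target_group[OF f]])
  qed
  have source: "compactin ball_aut_topology \<Gamma>\<^bsub>f\<^esub>" if "compactin ball_aut_topology T\<^bsub>f\<^esub>"
  proof -
    let ?K = "(\<lambda>\<psi>. \<psi> (f 0)) ` T\<^bsub>f\<^esub>"
    let ?L = "{z \<in> ball 0 1. f z \<in> ?K}"
    have "compactin (top_of_set (ball 0 1)) ?K"
      using that continuous_map_ball_aut_eval[OF f0] by (rule image_compactin)
    then have "compact ?K" "?K \<subseteq> ball 0 1"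
      by (simp_all add: compactin_subtopology)
    then have L: "compact ?L" "?L \<subseteq> ball 0 1"
      using D(3) by auto
    have "\<exists>\<psi>\<in>T\<^bsub>f\<^esub>. \<gamma> \<in> carrier ball_aut \<and> \<gamma> 0 \<in> ball 0 1 \<and> f (\<gamma> 0) = \<psi> (f 0)"
      if "\<gamma> \<in> \<Gamma>\<^bsub>f\<^esub>" for \<gamma>
      using that ball_aut_in_ball[of \<gamma> 0]
      by (fastforce simp: target_group_def source_group_def equivariance_group_def)
    then have "\<Gamma>\<^bsub>f\<^esub> \<subseteq> {\<gamma> \<in> carrier ball_aut. \<gamma> 0 \<in> ?L}" by blast
    then show ?thesis
      by (rule closed_compactin[OF compactin_ball_aut_eval[OF z0 L] _ closedin_source_group[OF f]])
  qed
  show ?thesis using target source by blast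
qed

theorem proposition2p3:
  fixes f :: "complex ^ 'n \<Rightarrow> complex ^ 'm"
  assumes "proper_holomorphic f"
  shows "ball_aut_lie_subgroup \<Gamma>\<^bsub>f\<^esub> \<and>
         ball_aut_lie_subgroup T\<^bsub>f\<^esub> \<and>
         (\<not> compactin ball_aut_topology \<Gamma>\<^bsub>f\<^esub> \<longleftrightarrow> \<not> compactin ball_aut_topology T\<^bsub>f\<^esub>)"
  unfolding ball_aut_lie_subgroup_def
  using subgroup_source_group[OF proper_holomorphicD(1)[OF assms]]
    subgroup_target_group[OF proper_holomorphicD(1)[OF assms]]
    closedin_source_group[OF assms] closedin_target_group[OF assms]
    compactin_source_group_iff_target_group[OF assms]
  by simp

end
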